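(* Let $V$ be a nonempty finite set. Every graph $I$ with vertex set $V$ possesses a universal interference (with some ground set $X$). In particular, every complete interference for $V$ is a universal interference with respect to every graph $I$ on the vertex set $V$.
   Context: All graphs are finite and simple. Let $I$ be a graph with vertex set $V$ (the interference graph), and let $X$ be a nonempty set (the ground set). An injective function $f: V\to 2^X\setminus\{\emptyset\}$ is an interference of a set $\emptyset\neq D\subseteq V$ with respect to $I$ if for every $u\in V\setminus D$ there exists $v\in D$ adjacent to $u$ in $I$ with $f(u)\cap f(v)\neq\emptyset$. A dominating set of $I$ is a nonempty set $D\subseteq V$ such that every vertex is in $D$ or adjacent in $I$ to a vertex of $D$. An injective $f: V\to 2^X\setminus\{\emptyset\}$ is a universal interference with respect to $I$ if it is an interference, with respect to $I$, of every dominating set of $I$. A complete interference for $V$ is an injective $f: V\to 2^X\setminus\{\emptyset\}$ with $f(u)\cap f(v)\neq\emptyset$ for all distinct $u,v\in V$ (equivalently, a universal interference with respect to the complete graph on $V$). *)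

theory Defs
  imports "Graph_Theory.Pair_Digraph"
begin

text \<open>A finite simple graph is a \<open>pair_graph\<close>: a finite, symmetric, loop-free set of ordered
  pairs of vertices. Its edge \<open>uv\<close> is represented by both arcs \<open>(u, v)\<close> and \<open>(v, u)\<close>.\<close>

abbreviation graph_on :: "'a set \<Rightarrow> 'a pair_pre_digraph \<Rightarrow> bool" where
  "graph_on V I \<equiv> pair_graph I \<and> pverts I = V"

text \<open>Functions on \<open>V\<close> are total HOL functions; their values outside \<open>V\<close> never matter.\<close>

definition set_labelling :: "'x set \<Rightarrow> 'a set \<Rightarrow> ('a \<Rightarrow> 'x set) \<Rightarrow> bool" where
  "set_labelling X V f \<longleftrightarrow> X \<noteq> {} \<and> f ` V \<subseteq> Pow X - {{}} \<and> inj_on f V"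

definition interference ::
  "'x set \<Rightarrow> 'a pair_pre_digraph \<Rightarrow> 'a set \<Rightarrow> ('a \<Rightarrow> 'x set) \<Rightarrow> bool" where
  "interference X I D f \<longleftrightarrow>
     set_labelling X (pverts I) f \<and> D \<noteq> {} \<and> D \<subseteq> pverts I \<and>
     (\<forall>u \<in> pverts I - D. \<exists>v \<in> D. (u, v) \<in> parcs I \<and> f u \<inter> f v \<noteq> {})"

definition dominating_set :: "'a pair_pre_digraph \<Rightarrow> 'a set \<Rightarrow> bool" where
  "dominating_set I D \<longleftrightarrow>
     D \<noteq> {} \<and> D \<subseteq> pverts I \<and> (\<forall>u \<in> pverts I. u \<in> D \<or> (\<exists>v \<in> D. (u, v) \<in> parcs I))"

definition universal_interference ::
  "'x set \<Rightarrow> 'a pair_pre_digraph \<Rightarrow> ('a \<Rightarrow> 'x set) \<Rightarrow> bool" where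
  "universal_interference X I f \<longleftrightarrow>
     set_labelling X (pverts I) f \<and> (\<forall>D. dominating_set I D \<longrightarrow> interference X I D f)"

definition complete_interference :: "'x set \<Rightarrow> 'a set \<Rightarrow> ('a \<Rightarrow> 'x set) \<Rightarrow> bool" where
  "complete_interference X V f \<longleftrightarrow>
     set_labelling X V f \<and> (\<forall>u \<in> V. \<forall>v \<in> V. u \<noteq> v \<longrightarrow> f u \<inter> f v \<noteq> {})"

end

theory Submission
  imports Defs
begin

text \<open>Domination already supplies every adjacency that an interference asks for: a vertex outside a
  dominating set \<open>D\<close> has a neighbour in \<open>D\<close>, and this neighbour is a different vertex. All that can
  fail is that the two labels meet, and a complete interference guarantees this for every pair of
  distinct vertices, whatever the edges are. So a complete interference is universal for every graph
  (\<open>universal_interference_if_complete\<close>), and it remains to see that a finite \<open>V\<close> has a complete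
  interference (\<open>exists_complete_interference\<close>): give all labels a common element.\<close>

lemma universal_interference_if_complete:
  assumes "complete_interference X (pverts I) f"
  shows "universal_interference X I f"
proof -
  have "interference X I D f" if D: "dominating_set I D" for D
  proof -
    have "\<exists>v \<in> D. (u, v) \<in> parcs I \<and> f u \<inter> f v \<noteq> {}" if u: "u \<in> pverts I - D" for u
    proof -
      from D u obtain v where v: "v \<in> D" "v \<in> pverts I" "(u, v) \<in> parcs I"
        unfolding dominating_set_def by blast
      moreover from u v have "u \<noteq> v" by blast
      ultimately show ?thesis
        using assms u unfolding complete_interference_def by blast
    qed
    then show ?thesis
      using assms D
      unfolding interference_def complete_interference_def dominating_set_def by blast
  qed
  then show ?thesis
    using assms unfolding universal_interference_def complete_interference_def by blast
qed

text \<open>The element \<open>0\<close> is shared by all labels, and a second, positive element encodes the vertex,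
  which keeps the labels distinct.\<close>

lemma exists_complete_interference:
  fixes V :: "'a set"
  assumes "finite V"
  shows "\<exists>f. complete_interference (UNIV :: nat set) V f"
proof -
  from assms obtain g :: "'a \<Rightarrow> nat" where g: "inj_on g V"
    using finite_imp_inj_to_nat_seg by blast
  let ?f = "\<lambda>v. {0, Suc (g v)}"
  have "inj_on ?f V"
    using g by (auto simp: inj_on_def doubleton_eq_iff)
  then have "complete_interference UNIV V ?f"
    by (auto simp: complete_interference_def set_labelling_def)
  then show ?thesis by blast
qed

theorem theorem2p3:
  fixes V :: "'a set"
  assumes "finite V" and "V \<noteq> {}"
  shows "(\<forall>I. graph_on V I \<longrightarrow>
            (\<exists>(X :: nat set) f. universal_interference X I f)) \<and>
         (\<forall>(X :: 'x set) f. complete_interference X V f \<longrightarrow>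
            (\<forall>I. graph_on V I \<longrightarrow> universal_interference X I f))"
proof -
  obtain g where "complete_interference (UNIV :: nat set) V g"
    using exists_complete_interference[OF assms(1)] ..
  then have "\<exists>(X :: nat set) f. universal_interference X I f" if "graph_on V I" for I
    using that universal_interference_if_complete[of UNIV I g] by auto
  moreover have "universal_interference X I f"
    if "complete_interference X V f" "graph_on V I" for X :: "'x set" and f I
    using that universal_interference_if_complete[of X I f] by simp
  ultimately show ?thesis by simp
qed

end
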